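(* Let $f\colon\mathbb{R}_+\to\mathbb{R}$ be a strictly increasing concave function with $f(1)=0$. Then the homogeneous deviation mean $\mathscr{E}_f$ is a Hardy mean if and only if $$\int_0^1 f\left(\frac{1}{t}\right)dt<+\infty,$$ and, if this inequality holds, then the Hardy constant of $\mathscr{E}_f$ is the unique positive solution $c$ of the equation $$\int_0^c f\left(\frac{1}{t}\right)dt=0.$$
   Context: $\mathbb{R}_+=(0,\infty)$. For a strictly increasing concave function $f\colon\mathbb{R}_+\to\mathbb{R}$ with $f(1)=0$, the homogeneous deviation mean $\mathscr{E}_f\colon\bigcup_{n=1}^\infty\mathbb{R}_+^n\to\mathbb{R}_+$ is defined as follows: for $n\in\mathbb{N}$ and $(x_1,\dots,x_n)\in\mathbb{R}_+^n$, $\mathscr{E}_f(x_1,\dots,x_n)$ is the unique solution $y\in\mathbb{R}_+$ of the equation $$f\left(\frac{x_1}{y}\right)+\cdots+f\left(\frac{x_n}{y}\right)=0.$$ For a mean $M\colon\bigcup_{n=1}^\infty\mathbb{R}_+^n\to\mathbb{R}_+$, the Hardy constant $\mathscr{H}(M)$ is the smallest nonnegative extended real number such that $$\sum_{n=1}^\infty M(x_1,\dots,x_n)\le\mathscr{H}(M)\sum_{n=1}^\infty x_n$$ for all sequences $(x_n)_{n=1}^\infty$ in $\mathbb{R}_+$; $M$ is called a Hardy mean if $\mathscr{H}(M)$ is finite. *)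

theory Defs
  imports "HOL-Analysis.Analysis"
begin

text \<open>The half-line of positive reals is rendered by the set \<open>{0<..}\<close>, and a vector of positive
  reals of arbitrary positive length by a nonempty list of positive reals.\<close>

definition hom_dev_mean :: "(real \<Rightarrow> real) \<Rightarrow> real list \<Rightarrow> real" where
  "hom_dev_mean f xs = (THE y. 0 < y \<and> (\<Sum>x\<leftarrow>xs. f (x / y)) = 0)"

definition hardy_bound :: "(real list \<Rightarrow> real) \<Rightarrow> ennreal \<Rightarrow> bool" where
  "hardy_bound M C \<longleftrightarrow>
     (\<forall>x :: nat \<Rightarrow> real. (\<forall>n. 0 < x n) \<longrightarrow>
        (\<Sum>n. ennreal (M (map x [0..<Suc n]))) \<le> C * (\<Sum>n. ennreal (x n)))"

definition hardy_constant :: "(real list \<Rightarrow> real) \<Rightarrow> ennreal" where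
  "hardy_constant M = (LEAST C. hardy_bound M C)"

definition hardy_mean :: "(real list \<Rightarrow> real) \<Rightarrow> bool" where
  "hardy_mean M \<longleftrightarrow> hardy_constant M < \<infinity>"


text \<open>Both descriptions above denote: the defining equation of the mean has a unique positive
  solution, and the smallest admissible constant exists.\<close>

lemma hom_dev_mean_ex1:
  fixes f :: "real \<Rightarrow> real" and xs :: "real list"
  assumes mono: "strict_mono_on {0<..} f" and conc: "concave_on {0<..} f" and f1: "f 1 = 0"
    and ne: "xs \<noteq> []" and pos: "\<And>x. x \<in> set xs \<Longrightarrow> 0 < x"
  shows "\<exists>!y. 0 < y \<and> (\<Sum>x\<leftarrow>xs. f (x / y)) = 0"
proof -
  define g where "g y = (\<Sum>x\<leftarrow>xs. f (x / y))" for y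
  have "continuous_on {0<..} (\<lambda>x. - f x)"
    using conc unfolding concave_on_def by (intro convex_on_continuous) auto
  then have cf: "continuous_on {0<..} f"
    using continuous_on_minus by fastforce
  have cg: "continuous_on {0<..} g"
  proof -
    have "continuous_on {0<..} (\<lambda>y. \<Sum>x\<leftarrow>zs. f (x / y))"
      if "\<And>x. x \<in> set zs \<Longrightarrow> 0 < x" for zs :: "real list"
      using that
    proof (induction zs)
      case (Cons a zs)
      have "continuous_on {0<..} (\<lambda>y. f (a / y))"
        by (rule continuous_on_compose2[OF cf]) (use Cons.prems in \<open>auto intro!: continuous_intros\<close>)
      then show ?case using Cons by (auto intro!: continuous_on_add)
    qed auto
    then show ?thesis using pos unfolding g_def by blast
  qed
  define a where "a = Min (set xs)"
  define b where "b = Max (set xs)"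
  have ab: "0 < a" "a \<le> b" "\<And>x. x \<in> set xs \<Longrightarrow> a \<le> x \<and> x \<le> b"
    using ne pos by (auto simp: a_def b_def)
  have fge: "0 \<le> f u" if "1 \<le> u" for u
    using strict_mono_onD[OF mono, of 1 u] that f1 by (cases "u = 1") auto
  have fle: "f u \<le> 0" if "0 < u" "u \<le> 1" for u
    using strict_mono_onD[OF mono, of u 1] that f1 by (cases "u = 1") auto
  have "0 \<le> g a"
    unfolding g_def using ab by (intro sum_list_nonneg) (auto intro!: fge)
  moreover have "g b \<le> 0"
    unfolding g_def using ab pos by (intro sum_list_nonpos) (auto intro!: fle simp: field_simps)
  moreover have "continuous_on {a..b} g"
    by (rule continuous_on_subset[OF cg]) (use ab in auto)
  ultimately obtain y where "a \<le> y" "y \<le> b" "g y = 0"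
    using IVT2'[of g b 0 a] ab by auto
  note y = this
  have less: "g z < g y" if "0 < y" "y < z" for y z
  proof -
    have "f (x / z) < f (x / y)" if "x \<in> set xs" for x
      using \<open>0 < y\<close> \<open>y < z\<close> pos[OF that]
      by (intro strict_mono_onD[OF mono]) (auto simp: divide_strict_left_mono)
    then show ?thesis unfolding g_def by (intro sum_list_strict_mono) (use ne in auto)
  qed
  show ?thesis
    unfolding g_def[symmetric]
  proof (intro ex1I[of _ y] conjI)
    show "0 < y" "g y = 0" using y ab by auto
    fix z assume z: "0 < z \<and> g z = 0"
    show "z = y"
      using less[of z y] less[of y z] z y ab by (cases z y rule: linorder_cases) auto
  qed
qed

lemma hardy_constant_least:
  assumes pos: "\<And>xs. xs \<noteq> [] \<Longrightarrow> (\<And>x. x \<in> set xs \<Longrightarrow> 0 < x) \<Longrightarrow> 0 < M xs"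
  shows "hardy_bound M (hardy_constant M)"
    and "hardy_bound M C \<Longrightarrow> hardy_constant M \<le> C"
proof -
  define L where "L x = (\<Sum>n. ennreal (M (map x [0..<Suc n])))" for x
  define S where "S x = (\<Sum>n. ennreal (x n))" for x :: "nat \<Rightarrow> real"
  have hb: "hardy_bound M C \<longleftrightarrow> (\<forall>x. (\<forall>n. 0 < x n) \<longrightarrow> L x \<le> C * S x)" for C
    unfolding hardy_bound_def L_def S_def by (rule refl)
  have term_le: "h 0 \<le> (\<Sum>n. h n)" for h :: "nat \<Rightarrow> ennreal"
    using sum_le_suminf[of h "{0}"] by simp
  have Lpos: "0 < L x" and Spos: "0 < S x" if "\<forall>n. 0 < x n" for x
  proof -
    have "0 < M (map x [0..<Suc 0])" by (rule pos) (use that in auto)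
    then have "0 < ennreal (M (map x [0..<Suc 0]))"
      by (rule iffD2[OF ennreal_less_zero_iff])
    also have "\<dots> \<le> L x"
      unfolding L_def by (rule term_le)
    finally show "0 < L x" .
    have "0 < ennreal (x 0)" using that by simp
    also have "\<dots> \<le> S x"
      unfolding S_def by (rule term_le)
    finally show "0 < S x" .
  qed
  define I where "I = Inf {C. hardy_bound M C}"
  have quot: "L x / S x \<le> I" if x: "\<forall>n. 0 < x n" and fin: "S x < top" for x
    unfolding I_def
  proof (rule Inf_greatest)
    fix C assume "C \<in> {C. hardy_bound M C}"
    then have "L x \<le> S x * C"
      using hb x by (simp add: mult.commute)
    then show "L x / S x \<le> C"
      by (rule divide_le_posI_ennreal[OF Spos[OF x]])
  qed
  define p where "p n = (1 / 2 :: real) ^ Suc n" for n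
  have "summable p"
    unfolding p_def using power_half_series by (rule sums_summable)
  then have "S p \<noteq> top"
    unfolding S_def by (rule ennreal_suminf_neq_top) (simp add: p_def)
  then have p: "\<forall>n. 0 < p n" "S p < top"
    by (simp_all add: p_def less_top)
  have "0 < L p / S p"
    using Lpos[OF p(1)] p(2) by (simp add: ennreal_zero_less_divide)
  then have "0 < I" using quot[OF p] by (rule less_le_trans)
  have "hardy_bound M I"
    unfolding hb
  proof (intro allI impI)
    fix x :: "nat \<Rightarrow> real" assume x: "\<forall>n. 0 < x n"
    show "L x \<le> I * S x"
    proof (cases "S x = top")
      case True then show ?thesis using \<open>0 < I\<close> by (simp add: ennreal_mult_top)
    next
      case False
      then have "S x < top" by (simp add: less_top)
      then have "L x / S x * S x \<le> I * S x"
        by (intro mult_right_mono quot x) auto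
      moreover have "L x / S x * S x = L x"
        using Spos[OF x] \<open>S x < top\<close>
        by (simp add: ennreal_divide_times)
      ultimately show ?thesis by simp
    qed
  qed
  moreover have "I \<le> D" if "hardy_bound M D" for D
    unfolding I_def using that by (intro Inf_lower) auto
  ultimately have "hardy_constant M = I"
    unfolding hardy_constant_def by (intro Least_equality)
  with \<open>hardy_bound M I\<close> \<open>\<And>D. hardy_bound M D \<Longrightarrow> I \<le> D\<close>
  show "hardy_bound M (hardy_constant M)" "hardy_bound M C \<Longrightarrow> hardy_constant M \<le> C"
    by auto
qed

end

theory Submission
  imports Defs
begin

text \<open>Write \<open>\<phi> t = f (1 / t)\<close>, which decreases, and \<open>\<Phi> r = \<integral>\<^sub>0\<^sup>r \<phi>\<close> when this integral converges.
  Then \<open>\<Phi>\<close> has exactly one zero \<open>c\<close> on the positive half-line, and \<open>0 \<le> \<Phi> r\<close> means \<open>r \<le> c\<close>.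

  Upper bound. Let \<open>y n\<close> be the mean of \<open>x 0, \<dots>, x (n - 1)\<close> for \<open>1 \<le> n \<le> N\<close>. Arranging
  \<open>x 0, \<dots>, x (N - 1)\<close> in decreasing order only increases the means, so let \<open>x\<close> be decreasing. The
  defining equation of \<open>y n\<close>, multiplied by \<open>1 / n\<close>, reads
  \<open>\<integral>\<^sub>0\<^sup>1 f (x \<lfloor>n * u\<rfloor> / y n) du = 0\<close>. This puts all the equations over one and the same
  parameter interval, so that for fixed \<open>u\<close> they can be summed over \<open>n\<close> with the weights \<open>y n\<close>. The
  perspective \<open>(x, y) \<mapsto> y * f (x / y)\<close> of a concave function is superadditive, and
  \<open>\<Sum> x \<lfloor>n * u\<rfloor> \<le> (\<Sum> x k) / u\<close> because \<open>x\<close> decreases; hence with \<open>X = \<Sum> x k\<close>, \<open>Y = \<Sum> y n\<close>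
  and \<open>r = Y / X\<close> the weighted sum is at most \<open>Y * \<phi> (r * u)\<close>. Integrating over \<open>u\<close> yields
  \<open>0 \<le> Y * \<Phi> r / r\<close>, so \<open>Y \<le> c * X\<close> (\<open>\<Phi>_mean_ratio_nonneg\<close>, \<open>hardy_bound_mean\<close>).

  Lower bound. For \<open>1, 1/2, 1/3, \<dots>\<close> the inequality \<open>d / n \<le> y n\<close> says that the right Riemann sum
  of \<open>\<phi>\<close> over \<open>[0, d]\<close> with step \<open>d / n\<close> is nonnegative, which holds for large \<open>n\<close> as soon as
  \<open>\<integral> \<phi>\<close> over some \<open>[\<epsilon>, d]\<close> with \<open>\<epsilon> \<le> 1\<close> is positive (\<open>eventually_le_mean_harmonic\<close>). Since the
  harmonic series diverges, the Hardy constant is then at least \<open>d\<close> (\<open>hardy_bound_ge\<close>). If the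
  integral converges at \<open>0\<close>, this applies to every \<open>d < c\<close>; if it diverges, to every \<open>d\<close>.\<close>

section \<open>Rearranging sequences and sampling them along an arithmetic progression\<close>

text \<open>Both sums are compared through \<open>\<Sum> max 0 (g x - g t)\<close>, taken over the whole
  list, where \<open>t\<close> is the smallest of the \<open>n\<close> retained entries: this quantity does not see the order
  of the list, it dominates \<open>\<Sum> (g x - g t)\<close> over any \<open>n\<close> entries, and it equals that sum for the
  \<open>n\<close> largest ones.\<close>

lemma sum_list_take_le_sorted:
  fixes g :: "real \<Rightarrow> real"
  assumes mono: "\<And>a b. a \<in> set xs \<Longrightarrow> b \<in> set xs \<Longrightarrow> a \<le> b \<Longrightarrow> g a \<le> g b"
    and n: "0 < n" "n \<le> length xs"
  shows "sum_list (map g (take n xs)) \<le> sum_list (map g (take n (rev (sort xs))))"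
proof -
  define zs where "zs = rev (sort xs)"
  have zs: "mset zs = mset xs" "set zs = set xs" "length zs = length xs" "sorted (rev zs)"
    by (auto simp: zs_def)
  define t where "t = zs ! (n - 1)"
  define h where "h x = max 0 (g x - g t)" for x
  have t: "t \<in> set xs"
    using n zs(3) nth_mem[of "n - 1" zs] unfolding t_def zs(2) by simp
  have anti: "zs ! j \<le> zs ! i" if "i \<le> j" "j < length zs" for i j
    using sorted_rev_nth_mono[OF zs(4) that] .
  have shift: "sum_list (map (\<lambda>x. g x - g t) ys) = sum_list (map g ys) - real (length ys) * g t"
    for ys by (induction ys) (auto simp: algebra_simps)
  have split: "sum_list (map h ys) = sum_list (map h (take n ys)) + sum_list (map h (drop n ys))"
    for ys by (metis append_take_drop_id map_append sum_list.append)
  have "sum_list (map (\<lambda>x. g x - g t) (take n xs)) \<le> sum_list (map h (take n xs))"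
    by (intro sum_list_mono) (simp add: h_def)
  also have "\<dots> \<le> sum_list (map h xs)"
    unfolding split[of xs] by (auto simp: h_def intro!: sum_list_nonneg)
  also have "\<dots> = sum_list (map h zs)"
    using zs(1) by (metis mset_map sum_mset_sum_list)
  \<comment> \<open>The entries after the \<open>n\<close> largest ones are at most \<open>t\<close> and contribute nothing.\<close>
  also have "\<dots> = sum_list (map h (take n zs))"
  proof -
    have "h x = 0" if x: "x \<in> set (drop n zs)" for x
    proof -
      obtain i where i: "i < length zs - n" "x = zs ! (n + i)"
        using x n zs(3) by (auto simp: in_set_conv_nth)
      then have "x \<le> t" unfolding t_def i(2) using n by (intro anti) auto
      moreover have "x \<in> set xs" using x set_drop_subset[of n zs] zs(2) by auto
      ultimately show ?thesis using mono[of x t] t by (simp add: h_def)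
    qed
    then have "sum_list (map h (drop n zs)) = 0"
      by (simp add: sum_list_0 cong: map_cong)
    then show ?thesis unfolding split[of zs] by simp
  qed
  also have "\<dots> = sum_list (map (\<lambda>x. g x - g t) (take n zs))"
  proof -
    have "h x = g x - g t" if x: "x \<in> set (take n zs)" for x
    proof -
      obtain i where i: "i < n" "x = zs ! i"
        using x n zs(3) by (auto simp: in_set_conv_nth)
      then have "t \<le> x" unfolding t_def i(2) using n zs(3) by (intro anti) auto
      moreover have "x \<in> set xs" using x set_take_subset[of n zs] zs(2) by auto
      ultimately show ?thesis using mono[of t x] t by (simp add: h_def)
    qed
    then show ?thesis by (simp cong: map_cong)
  qed
  finally show ?thesis
    unfolding shift using n zs(3) by (simp add: zs_def)
qed

text \<open>Regard \<open>x\<close> as a decreasing step function with value \<open>x k\<close> on \<open>[k, k + 1)\<close>. Then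
  \<open>u * x \<lfloor>n * u\<rfloor>\<close> is at most the integral of this function over \<open>[(n - 1) * u, n * u]\<close>, and the
  right-hand side is its integral over \<open>[0, m * u]\<close>.\<close>

lemma sampled_sum_le_step_integral:
  fixes x :: "nat \<Rightarrow> real" and u :: real
  assumes dec: "\<And>i j. i \<le> j \<Longrightarrow> j < N \<Longrightarrow> x j \<le> x i"
    and u: "0 < u" "u < 1" and m: "m \<le> N"
  shows "u * (\<Sum>n=1..m. x (nat \<lfloor>real n * u\<rfloor>))
           \<le> (\<Sum>k<nat \<lfloor>real m * u\<rfloor>. x k) + frac (real m * u) * x (nat \<lfloor>real m * u\<rfloor>)"
  using m
proof (induction m)
  case 0
  then show ?case by simp
next
  case (Suc m)
  define a where "a = real m * u"
  have a0: "0 \<le> a" unfolding a_def using u by simp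
  have Sa: "real (Suc m) * u = a + u" by (simp add: a_def algebra_simps)
  have "real (Suc m) * u < real (Suc m)" using u by simp
  then have lt: "nat \<lfloor>a + u\<rfloor> < Suc m" unfolding Sa using a0 u by linarith
  have IH: "u * (\<Sum>n=1..m. x (nat \<lfloor>real n * u\<rfloor>))
     \<le> (\<Sum>k<nat \<lfloor>a\<rfloor>. x k) + frac a * x (nat \<lfloor>a\<rfloor>)"
    using Suc unfolding a_def by simp
  have "(\<Sum>k<nat \<lfloor>a\<rfloor>. x k) + frac a * x (nat \<lfloor>a\<rfloor>) + u * x (nat \<lfloor>a + u\<rfloor>)
      \<le> (\<Sum>k<nat \<lfloor>a + u\<rfloor>. x k) + frac (a + u) * x (nat \<lfloor>a + u\<rfloor>)"
    \<comment> \<open>The interval \<open>[a, a + u]\<close> is shorter than 1, so it contains at most one jump.\<close>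
  proof (cases "frac a + u < 1")
    case True
    then have "\<lfloor>a + u\<rfloor> = \<lfloor>a\<rfloor>" using u unfolding frac_def by linarith
    moreover from this have "frac (a + u) = frac a + u" by (simp add: frac_def)
    ultimately show ?thesis by (simp add: algebra_simps)
  next
    case False
    then have fl: "\<lfloor>a + u\<rfloor> = \<lfloor>a\<rfloor> + 1" using u unfolding frac_def by linarith
    then have n: "nat \<lfloor>a + u\<rfloor> = Suc (nat \<lfloor>a\<rfloor>)" using a0 by linarith
    have fr: "frac (a + u) = frac a + u - 1" using fl by (simp add: frac_def)
    have "x (Suc (nat \<lfloor>a\<rfloor>)) \<le> x (nat \<lfloor>a\<rfloor>)"
      using lt n Suc.prems by (intro dec) auto
    then have "(1 - frac a) * x (Suc (nat \<lfloor>a\<rfloor>)) \<le> (1 - frac a) * x (nat \<lfloor>a\<rfloor>)"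
      using frac_lt_1[of a] by (intro mult_left_mono) auto
    then show ?thesis unfolding n fr by (simp add: algebra_simps)
  qed
  with IH show ?case
    by (simp only: sum.cl_ivl_Suc Sa) (simp add: distrib_left Sa del: of_nat_Suc)
qed

lemma sampled_sum_le:
  fixes x :: "nat \<Rightarrow> real"
  assumes dec: "\<And>i j. i \<le> j \<Longrightarrow> j < N \<Longrightarrow> x j \<le> x i" and pos: "\<And>k. k < N \<Longrightarrow> 0 \<le> x k"
    and u: "0 < u" "u < 1" and N: "0 < N"
  shows "u * (\<Sum>n=1..N. x (nat \<lfloor>real n * u\<rfloor>)) \<le> (\<Sum>k<N. x k)"
proof -
  define m where "m = nat \<lfloor>real N * u\<rfloor>"
  have "real N * u < real N" using u N by simp
  moreover have "0 \<le> real N * u" using u by simp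
  ultimately have m: "m < N" unfolding m_def by linarith
  have "u * (\<Sum>n=1..N. x (nat \<lfloor>real n * u\<rfloor>)) \<le> (\<Sum>k<m. x k) + frac (real N * u) * x m"
    unfolding m_def by (rule sampled_sum_le_step_integral[OF dec u]) auto
  also have "\<dots> \<le> (\<Sum>k<m. x k) + 1 * x m"
    by (intro add_left_mono mult_right_mono pos m less_imp_le[OF frac_lt_1])
  also have "\<dots> = (\<Sum>k<Suc m. x k)" by simp
  also have "\<dots> \<le> (\<Sum>k<N. x k)"
    by (rule sum_mono2) (use m pos in auto)
  finally show ?thesis .
qed

text \<open>An average over \<open>n\<close> indices becomes an integral over \<open>[0, 1]\<close>, an interval that is the same
  for all \<open>n\<close>; this is what makes averages of different lengths comparable pointwise.\<close>

lemma has_integral_sampled: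
  fixes h :: "nat \<Rightarrow> real"
  assumes n: "0 < n"
  shows "((\<lambda>u. h (nat \<lfloor>real n * u\<rfloor>)) has_integral (\<Sum>k<n. h k) / real n) {0..1}"
proof -
  have "((\<lambda>u. h (nat \<lfloor>real n * u\<rfloor>)) has_integral (\<Sum>k<m. h k) / real n) {0..real m / real n}" for m
  proof (induction m)
    case 0
    then show ?case by (simp add: has_integral_refl)
  next
    case (Suc m)
    have "((\<lambda>u. h m) has_integral h m / real n) {real m / real n..real (Suc m) / real n}"
      using has_integral_const_real[of "h m" "real m / real n" "real (Suc m) / real n"]
      by (simp add: diff_divide_distrib[symmetric] divide_right_mono)
    moreover have "h (nat \<lfloor>real n * u\<rfloor>) = h m"
      if "u \<in> {real m / real n<..<real (Suc m) / real n}" for u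
    proof -
      have "real m < real n * u" "real n * u < real m + 1"
        using that n by (auto simp: field_simps)
      then have "\<lfloor>real n * u\<rfloor> = int m" by linarith
      then show ?thesis by simp
    qed
    ultimately have "((\<lambda>u. h (nat \<lfloor>real n * u\<rfloor>)) has_integral h m / real n)
        {real m / real n..real (Suc m) / real n}"
      unfolding has_integral_Icc_iff_Ioo by (subst has_integral_cong) auto
    from has_integral_combine[OF _ _ Suc this] show ?case
      by (simp add: divide_right_mono add_divide_distrib)
  qed
  from this[of n] show ?thesis using n by simp
qed

section \<open>Homogeneous deviation means\<close>

locale deviation =
  fixes f :: "real \<Rightarrow> real"
  assumes strict_mono: "strict_mono_on {0<..} f"
    and concave: "concave_on {0<..} f"
    and f_1: "f 1 = 0"
begin

lemma f_less: "0 < a \<Longrightarrow> a < b \<Longrightarrow> f a < f b"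
  using strict_mono_onD[OF strict_mono, of a b] by simp

lemma f_mono: "0 < a \<Longrightarrow> a \<le> b \<Longrightarrow> f a \<le> f b"
  using f_less[of a b] by (cases "a = b") auto

lemma continuous_f: "continuous_on {0<..} f"
proof -
  have "continuous_on {0<..} (\<lambda>x. - f x)"
    using concave unfolding concave_on_def by (intro convex_on_continuous) auto
  then show ?thesis
    using continuous_on_minus by fastforce
qed

text \<open>The perspective \<open>(x, y) \<mapsto> y * f (x / y)\<close> of \<open>f\<close> is concave and positively homogeneous,
  hence superadditive.\<close>

lemma perspective_superadditive:
  assumes fin: "finite S" "S \<noteq> {}" and y: "\<And>i. i \<in> S \<Longrightarrow> 0 < y i" and x: "\<And>i. i \<in> S \<Longrightarrow> 0 < x i"
  shows "(\<Sum>i\<in>S. y i * f (x i / y i)) \<le> sum y S * f (sum x S / sum y S)"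
proof -
  have Y: "0 < sum y S" using fin y by (intro sum_pos) auto
  have "(\<Sum>i\<in>S. y i / sum y S * f (x i / y i)) \<le> f (\<Sum>i\<in>S. (y i / sum y S) *\<^sub>R (x i / y i))"
    using Y y x
    by (intro concave_on_sum[OF fin concave])
       (auto simp: sum_divide_distrib[symmetric] intro!: divide_nonneg_pos less_imp_le[OF y])
  also have "(\<Sum>i\<in>S. (y i / sum y S) *\<^sub>R (x i / y i)) = sum x S / sum y S"
    unfolding sum_divide_distrib by (intro sum.cong) (use y in force)+
  also have "(\<Sum>i\<in>S. y i / sum y S * f (x i / y i)) = (\<Sum>i\<in>S. y i * f (x i / y i)) / sum y S"
    by (simp add: sum_divide_distrib)
  finally show ?thesis using Y by (simp add: field_simps)
qed

lemma mean_solves: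
  assumes "xs \<noteq> []" "\<And>x. x \<in> set xs \<Longrightarrow> 0 < x"
  shows "0 < hom_dev_mean f xs" "(\<Sum>x\<leftarrow>xs. f (x / hom_dev_mean f xs)) = 0"
  using theI'[OF hom_dev_mean_ex1[OF strict_mono concave f_1 assms]]
  unfolding hom_dev_mean_def by auto

lemma le_mean_iff:
  assumes xs: "xs \<noteq> []" "\<And>x. x \<in> set xs \<Longrightarrow> 0 < x" and y: "0 < y"
  shows "y \<le> hom_dev_mean f xs \<longleftrightarrow> 0 \<le> (\<Sum>x\<leftarrow>xs. f (x / y))"
proof -
  define E where "E = hom_dev_mean f xs"
  note E = mean_solves[OF xs, folded E_def]
  have less: "(\<Sum>x\<leftarrow>xs. f (x / b)) < (\<Sum>x\<leftarrow>xs. f (x / a))" if "0 < a" "a < b" for a b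
    using xs that by (intro sum_list_strict_mono f_less) (auto intro!: divide_strict_left_mono)
  show ?thesis
    using less[of y E] less[of E y] E y unfolding E_def[symmetric]
    by (cases y E rule: linorder_cases) auto
qed

text \<open>Sorting in decreasing order moves the largest entries into every initial segment, so it can
  only increase the means of the initial segments. This reduces the Hardy inequality to decreasing
  sequences.\<close>

lemma mean_take_le_sorted:
  assumes "\<And>x. x \<in> set xs \<Longrightarrow> 0 < x" and n: "0 < n" "n \<le> length xs"
  shows "hom_dev_mean f (take n xs) \<le> hom_dev_mean f (take n (rev (sort xs)))"
proof -
  define y where "y = hom_dev_mean f (take n xs)"
  have p: "0 < x" if "x \<in> set (take n xs)" for x using that assms(1) set_take_subset by fastforce
  have q: "0 < x" if "x \<in> set (take n (rev (sort xs)))" for x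
  proof -
    have "x \<in> set (rev (sort xs))" using that by (rule in_set_takeD)
    then show ?thesis using assms(1) by simp
  qed
  have ne: "take n xs \<noteq> []" "take n (rev (sort xs)) \<noteq> []"
    using n by (auto simp flip: length_0_conv)
  note y = mean_solves[OF ne(1) p, folded y_def]
  have "(\<Sum>x\<leftarrow>take n xs. f (x / y)) \<le> (\<Sum>x\<leftarrow>take n (rev (sort xs)). f (x / y))"
    using assms y(1)
    by (intro sum_list_take_le_sorted f_mono) (auto intro!: divide_right_mono)
  then show ?thesis
    unfolding y_def[symmetric] using y by (subst le_mean_iff[OF ne(2) q]) auto
qed

section \<open>The function \<open>t \<mapsto> f (1 / t)\<close> and its primitive\<close>

abbreviation \<phi> :: "real \<Rightarrow> real" where "\<phi> t \<equiv> f (1 / t)"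

lemma \<phi>_less: "0 < a \<Longrightarrow> a < b \<Longrightarrow> \<phi> b < \<phi> a"
  by (intro f_less) (auto simp: field_simps)

lemma \<phi>_antimono: "0 < a \<Longrightarrow> a \<le> b \<Longrightarrow> \<phi> b \<le> \<phi> a"
  by (intro f_mono) (auto simp: field_simps)

lemma \<phi>_nonneg: "0 < a \<Longrightarrow> a \<le> 1 \<Longrightarrow> 0 \<le> \<phi> a"
  using \<phi>_antimono[of a 1] f_1 by simp

lemma continuous_\<phi>: "continuous_on {0<..} \<phi>"
  by (rule continuous_on_compose2[OF continuous_f]) (auto intro!: continuous_intros)

lemma integrable_\<phi>: "0 < a \<Longrightarrow> \<phi> integrable_on {a..b}"
  by (intro integrable_continuous_real continuous_on_subset[OF continuous_\<phi>]) auto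

lemma integral_\<phi>_bounds:
  assumes "0 < a" "a \<le> b"
  shows "(b - a) * \<phi> b \<le> integral {a..b} \<phi>" "integral {a..b} \<phi> \<le> (b - a) * \<phi> a"
proof -
  note int = integrable_\<phi>[OF \<open>0 < a\<close>, of b]
  have "integral {a..b} (\<lambda>t. \<phi> b) \<le> integral {a..b} \<phi>"
    using assms by (intro integral_le int) (auto intro!: \<phi>_antimono)
  then show "(b - a) * \<phi> b \<le> integral {a..b} \<phi>" using assms by simp
  have "integral {a..b} \<phi> \<le> integral {a..b} (\<lambda>t. \<phi> a)"
    using assms by (intro integral_le int) (auto intro!: \<phi>_antimono)
  then show "integral {a..b} \<phi> \<le> (b - a) * \<phi> a" using assms by simp
qed

lemma integral_\<phi>_le_riemann_sum:
  assumes "0 < a" "0 \<le> h"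
  shows "integral {a..a + real n * h} \<phi> \<le> (\<Sum>k<n. h * \<phi> (a + real k * h))"
proof (induction n)
  case (Suc n)
  define b where "b = a + real n * h"
  have b: "a \<le> b" "b \<le> b + h" "a + real (Suc n) * h = b + h"
    using assms by (auto simp: b_def algebra_simps)
  have "integral {a..b + h} \<phi> = integral {a..b} \<phi> + integral {b..b + h} \<phi>"
    using b integrable_\<phi>[OF assms(1)] by (simp add: Henstock_Kurzweil_Integration.integral_combine)
  then show ?case
    using Suc integral_\<phi>_bounds(2)[of b "b + h"] assms b
    unfolding b(3) b_def[symmetric] sum.lessThan_Suc by simp
qed simp


text \<open>With \<open>h = d / n\<close>, the sum that decides whether \<open>h\<close> is below the mean of
  \<open>1, 1/2, \<dots>, 1/n\<close> is, up to the factor \<open>h\<close>, a right Riemann sum of \<open>\<phi>\<close> over \<open>[0, d]\<close>. As \<open>\<phi>\<close>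
  decreases, it is at least the integral over \<open>[h, d + h]\<close>; as \<open>\<phi>\<close> is nonnegative on \<open>(0, \<epsilon>]\<close>, this
  is at least the integral over \<open>[\<epsilon>, d]\<close>, up to a tail that vanishes with \<open>h\<close>.\<close>

lemma eventually_le_mean_harmonic:
  assumes e: "0 < \<epsilon>" "\<epsilon> \<le> 1" "\<epsilon> \<le> d" and I: "0 < integral {\<epsilon>..d} \<phi>"
  shows "\<forall>\<^sub>F n in sequentially. d / real n \<le> hom_dev_mean f (map (\<lambda>k. 1 / real (Suc k)) [0..<n])"
proof -
  have d: "0 < d" using e by simp
  have lim0: "(\<lambda>n. d / real n) \<longlonglongrightarrow> 0"
    by (rule lim_const_over_n)
  have "(\<lambda>n. integral {\<epsilon>..d} \<phi> + d / real n * \<phi> (2 * d)) \<longlonglongrightarrow> integral {\<epsilon>..d} \<phi> + 0 * \<phi> (2 * d)"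
    by (intro tendsto_intros lim0)
  then have "\<forall>\<^sub>F n in sequentially. 0 < integral {\<epsilon>..d} \<phi> + d / real n * \<phi> (2 * d)"
    using I by (intro order_tendstoD(1)[of _ "integral {\<epsilon>..d} \<phi>"]) auto
  moreover have "\<forall>\<^sub>F n in sequentially. d / real n < \<epsilon>"
    using e by (intro order_tendstoD(2)[OF lim0])
  ultimately show ?thesis
    using eventually_gt_at_top[of "0::nat"]
  proof eventually_elim
    case (elim n)
    define h where "h = d / real n"
    have h: "0 < h" "h < \<epsilon>" using elim d by (auto simp: h_def)
    have nh: "real n * h = d" using elim by (simp add: h_def)
    have int: "\<phi> integrable_on {h..b}" for b using h integrable_\<phi> by blast
    have "0 < integral {\<epsilon>..d} \<phi> + h * \<phi> (2 * d)" using elim by (simp add: h_def)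
    also have "h * \<phi> (2 * d) \<le> h * \<phi> (d + h)"
      using h d e by (intro mult_left_mono \<phi>_antimono) auto
    also have "h * \<phi> (d + h) \<le> integral {d..d + h} \<phi>"
      using integral_\<phi>_bounds(1)[of d "d + h"] d h by simp
    also have "integral {\<epsilon>..d} \<phi> \<le> integral {h..\<epsilon>} \<phi> + integral {\<epsilon>..d} \<phi>"
    proof -
      have "0 \<le> integral {h..\<epsilon>} \<phi>"
        using h e by (intro Henstock_Kurzweil_Integration.integral_nonneg int) (auto intro!: \<phi>_nonneg)
      then show ?thesis by simp
    qed
    also have "integral {h..\<epsilon>} \<phi> + integral {\<epsilon>..d} \<phi> = integral {h..d} \<phi>"
      using h e by (intro Henstock_Kurzweil_Integration.integral_combine int) auto
    also have "integral {h..d} \<phi> + integral {d..d + h} \<phi> = integral {h..h + real n * h} \<phi>"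
      unfolding nh add.commute[of h d]
      using h e by (intro Henstock_Kurzweil_Integration.integral_combine int) auto
    also have "\<dots> \<le> (\<Sum>k<n. h * \<phi> (h + real k * h))"
      using h by (intro integral_\<phi>_le_riemann_sum) auto
    also have "\<dots> = h * (\<Sum>k<n. f (1 / real (Suc k) / h))"
      by (simp add: sum_distrib_left algebra_simps)
    finally have "0 < (\<Sum>k<n. f (1 / real (Suc k) / h))"
      using h by (simp add: zero_less_mult_iff del: of_nat_Suc)
    moreover have "(\<Sum>x\<leftarrow>map (\<lambda>k. 1 / real (Suc k)) [0..<n]. f (x / h))
        = (\<Sum>k<n. f (1 / real (Suc k) / h))"
      by (simp add: o_def interv_sum_list_conv_sum_set_nat atLeast0LessThan del: of_nat_Suc)
    ultimately show ?case
      unfolding h_def[symmetric] using h elim by (subst le_mean_iff) auto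
  qed
qed

section \<open>The sharp constant when the integral converges\<close>

definition \<Phi> :: "real \<Rightarrow> real" where "\<Phi> r = integral {0..r} \<phi>"

context
  assumes int01: "\<phi> integrable_on {0..1}"
begin

lemma integrable_\<phi>_0: "\<phi> integrable_on {0..r}"
proof (cases "r \<le> 1")
  case True
  then show ?thesis by (intro integrable_subinterval_real[OF int01]) auto
next
  case False
  then show ?thesis
    by (intro Henstock_Kurzweil_Integration.integrable_combine[of 0 1 r] int01 integrable_\<phi>) auto
qed

lemma \<Phi>_diff: "0 \<le> a \<Longrightarrow> a \<le> b \<Longrightarrow> \<Phi> b = \<Phi> a + integral {a..b} \<phi>"
  unfolding \<Phi>_def
  by (intro Henstock_Kurzweil_Integration.integral_combine[symmetric] integrable_\<phi>_0)

lemma \<Phi>_pos: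
  assumes "0 < r" "r \<le> 1"
  shows "0 < \<Phi> r"
proof -
  have nonneg: "0 \<le> integral {a..b} \<phi>" if "0 \<le> a" "b \<le> 1" for a b
  proof -
    have "0 \<le> integral {a<..<b} \<phi>"
      using that
      by (intro Henstock_Kurzweil_Integration.integral_nonneg)
         (auto intro!: \<phi>_nonneg integrable_subinterval_real[OF int01] simp flip: integrable_on_Icc_iff_Ioo)
    then show ?thesis by (simp add: integral_open_interval_real)
  qed
  have "0 < \<phi> (r / 2)" using \<phi>_less[of "r / 2" 1] assms f_1 by simp
  then have "0 < (r / 2 - r / 4) * \<phi> (r / 2)" using assms by simp
  also have "\<dots> \<le> integral {r / 4..r / 2} \<phi>"
    using assms by (intro integral_\<phi>_bounds) auto
  also have "\<dots> \<le> \<Phi> r"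
    using \<Phi>_diff[of "r / 4" "r / 2"] \<Phi>_diff[of "r / 2" r] nonneg[of 0 "r / 4"] nonneg[of "r / 2" r] assms
    by (simp add: \<Phi>_def)
  finally show ?thesis .
qed

text \<open>The primitive \<open>\<Phi>\<close> is positive on \<open>(0, 1]\<close>, where \<open>\<phi>\<close> is nonnegative, and on \<open>[1, \<infinity>)\<close> it
  strictly decreases to \<open>-\<infinity>\<close>, since \<open>\<phi>\<close> is negative on \<open>(1, \<infinity>)\<close> and at most \<open>f (1 / 2)\<close> on
  \<open>[2, \<infinity>)\<close>.\<close>

lemma \<Phi>_zero_exists:
  obtains c where "0 < c" "\<Phi> c = 0" "\<And>r. 0 < r \<Longrightarrow> r < c \<Longrightarrow> 0 < \<Phi> r" "\<And>r. c < r \<Longrightarrow> \<Phi> r < 0"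
proof -
  have \<phi>_neg: "\<phi> t < 0" if "1 < t" for t using \<phi>_less[of 1 t] that f_1 by simp
  \<comment> \<open>Far enough to the right of 2 for the linear bound with slope \<open>\<phi> 2\<close> to use up \<open>\<Phi> 2\<close>.\<close>
  define b where "b = 2 + \<bar>\<Phi> 2\<bar> / (- \<phi> 2)"
  have b: "2 \<le> b" using \<phi>_neg[of 2] unfolding b_def by (simp add: divide_nonneg_neg)
  have "\<Phi> b \<le> \<Phi> 2 + (b - 2) * \<phi> 2"
    using \<Phi>_diff[of 2 b] integral_\<phi>_bounds(2)[of 2 b] b by simp
  also have "(b - 2) * \<phi> 2 = - \<bar>\<Phi> 2\<bar>" unfolding b_def using \<phi>_neg[of 2] by simp
  finally have "\<Phi> b \<le> 0" by simp
  moreover have "continuous_on {1..b} \<Phi>"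
    unfolding \<Phi>_def
    by (rule continuous_on_subset[OF indefinite_integral_continuous_1[OF integrable_\<phi>_0]]) auto
  ultimately obtain c where c: "1 \<le> c" "\<Phi> c = 0"
    using IVT2'[of \<Phi> b 0 1] \<Phi>_pos[of 1] b by auto
  have "c \<noteq> 1" using c \<Phi>_pos[of 1] by auto
  show ?thesis
  proof
    show "0 < c" "\<Phi> c = 0" using c by auto
    show "0 < \<Phi> r" if r: "0 < r" "r < c" for r
    proof (cases "r \<le> 1")
      case False
      then have "integral {r..c} \<phi> \<le> (c - r) * \<phi> r" using r by (intro integral_\<phi>_bounds) auto
      also have "\<dots> < 0" using \<phi>_neg[of r] r False by (simp add: mult_pos_neg)
      finally show ?thesis using \<Phi>_diff[of r c] r c by simp
    qed (use \<Phi>_pos r in auto)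
    show "\<Phi> r < 0" if r: "c < r" for r
    proof -
      have "integral {c..r} \<phi> \<le> (r - c) * \<phi> c" using r c by (intro integral_\<phi>_bounds) auto
      also have "\<dots> < 0" using \<phi>_neg[of c] r c \<open>c \<noteq> 1\<close> by (simp add: mult_pos_neg)
      finally show ?thesis using \<Phi>_diff[of c r] r c by simp
    qed
  qed
qed

text \<open>The equation defining the mean \<open>y n\<close> of \<open>x 0, \<dots>, x (n - 1)\<close> says that
  \<open>u \<mapsto> f (x \<lfloor>n * u\<rfloor> / y n)\<close> has integral \<open>0\<close> over \<open>[0, 1]\<close>, for every \<open>n\<close> over the same interval.
  For fixed \<open>u\<close>, superadditivity of the perspective bounds the sum over \<open>n\<close> of
  \<open>y n * f (x \<lfloor>n * u\<rfloor> / y n)\<close> by \<open>Y * f (X / (u * Y))\<close>, where \<open>X\<close> and \<open>Y\<close> are the total sums of \<open>x\<close>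
  and \<open>y\<close>. The integral of this bound over \<open>u\<close> is a positive multiple of \<open>\<Phi> (Y / X)\<close>.\<close>

lemma \<Phi>_mean_ratio_nonneg:
  fixes x :: "nat \<Rightarrow> real"
  assumes dec: "\<And>i j. i \<le> j \<Longrightarrow> j < N \<Longrightarrow> x j \<le> x i" and pos: "\<And>k. k < N \<Longrightarrow> 0 < x k"
    and N: "0 < N"
  shows "0 \<le> \<Phi> ((\<Sum>n=1..N. hom_dev_mean f (map x [0..<n])) / (\<Sum>k<N. x k))"
proof -
  define y where "y n = hom_dev_mean f (map x [0..<n])" for n
  define X where "X = (\<Sum>k<N. x k)"
  define Y where "Y = (\<Sum>n=1..N. y n)"
  have y: "0 < y n" "(\<Sum>k<n. f (x k / y n)) = 0" if "n \<in> {1..N}" for n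
  proof -
    have "map x [0..<n] \<noteq> []" "\<And>a. a \<in> set (map x [0..<n]) \<Longrightarrow> 0 < a" using that pos by auto
    note mean_solves[OF this, folded y_def]
    then show "0 < y n" "(\<Sum>k<n. f (x k / y n)) = 0"
      by (simp_all add: o_def interv_sum_list_conv_sum_set_nat atLeast0LessThan)
  qed
  have X: "0 < X" unfolding X_def using N pos by (intro sum_pos) auto
  have Y: "0 < Y" unfolding Y_def using N y by (intro sum_pos) auto
  define r where "r = Y / X"
  have r: "0 < r" using X Y by (simp add: r_def)
  have "((\<lambda>u. \<Sum>n=1..N. y n * f (x (nat \<lfloor>real n * u\<rfloor>) / y n)) has_integral
      (\<Sum>n=1..N. y n * ((\<Sum>k<n. f (x k / y n)) / real n))) {0..1}"
    by (intro has_integral_sum has_integral_mult_right) (auto intro: has_integral_sampled)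
  then have left: "((\<lambda>u. \<Sum>n=1..N. y n * f (x (nat \<lfloor>real n * u\<rfloor>) / y n)) has_integral 0) {0<..<1}"
    using y by (simp add: has_integral_Icc_iff_Ioo)
  have "(\<phi> has_integral \<Phi> r) {0..r}"
    unfolding \<Phi>_def by (rule integrable_integral[OF integrable_\<phi>_0])
  from has_integral_stretch_real[OF this, of r] r
  have "((\<lambda>u. \<phi> (r * u)) has_integral \<Phi> r / r) {0..1}"
    by (simp add: image_divide_atLeastAtMost)
  then have right: "((\<lambda>u. Y * \<phi> (r * u)) has_integral Y * (\<Phi> r / r)) {0<..<1}"
    by (intro has_integral_mult_right) (simp add: has_integral_Icc_iff_Ioo)
  have "0 \<le> Y * (\<Phi> r / r)"
  proof (rule has_integral_le[OF left right])
    fix u :: real assume "u \<in> {0<..<1}"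
    then have u: "0 < u" "u < 1" by auto
    have idx: "nat \<lfloor>real n * u\<rfloor> < N" if "n \<in> {1..N}" for n
    proof -
      have "real n * u < real n" "0 \<le> real n * u" using that u by auto
      then have "nat \<lfloor>real n * u\<rfloor> < n" by linarith
      then show ?thesis using that by simp
    qed
    define S where "S = (\<Sum>n=1..N. x (nat \<lfloor>real n * u\<rfloor>))"
    have S: "0 < S" unfolding S_def using N by (intro sum_pos pos idx) auto
    have "u * S \<le> X"
      unfolding S_def X_def using pos by (intro sampled_sum_le dec u N) (auto intro: less_imp_le)
    then have "S / Y \<le> 1 / (r * u)"
      using u X Y by (simp add: r_def field_simps)
    have "(\<Sum>n=1..N. y n * f (x (nat \<lfloor>real n * u\<rfloor>) / y n)) \<le> Y * f (S / Y)"
      unfolding Y_def S_def using N y idx by (intro perspective_superadditive pos) auto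
    also have "\<dots> \<le> Y * \<phi> (r * u)"
      using S Y \<open>S / Y \<le> 1 / (r * u)\<close> by (intro mult_left_mono f_mono) auto
    finally show "(\<Sum>n=1..N. y n * f (x (nat \<lfloor>real n * u\<rfloor>) / y n)) \<le> Y * \<phi> (r * u)" .
  qed
  then have "0 \<le> \<Phi> r" using Y r by (simp add: zero_le_mult_iff zero_le_divide_iff)
  then show ?thesis by (simp add: r_def X_def Y_def y_def)
qed

lemma sum_means_le:
  fixes x :: "nat \<Rightarrow> real"
  assumes c: "\<And>r. c < r \<Longrightarrow> \<Phi> r < 0" and pos: "\<And>k. 0 < x k"
  shows "(\<Sum>n<N. hom_dev_mean f (map x [0..<Suc n])) \<le> c * (\<Sum>k<N. x k)"
proof (cases "N = 0")
  case False
  define xs where "xs = map x [0..<N]"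
  define zs where "zs = rev (sort xs)"
  have xs: "length xs = N" "\<And>a. a \<in> set xs \<Longrightarrow> 0 < a" using pos by (auto simp: xs_def)
  have zs: "length zs = N" "mset zs = mset xs" "set zs = set xs" "sorted (rev zs)"
    using xs by (auto simp: zs_def)
  have X: "(\<Sum>k<N. zs ! k) = (\<Sum>k<N. x k)"
  proof -
    have "(\<Sum>k<N. zs ! k) = sum_list zs" using zs by (simp add: sum_list_sum_nth atLeast0LessThan)
    also have "\<dots> = sum_list xs" using zs by (metis sum_mset_sum_list)
    also have "\<dots> = (\<Sum>k<N. x k)"
      by (simp add: xs_def interv_sum_list_conv_sum_set_nat atLeast0LessThan)
    finally show ?thesis .
  qed
  have "(\<Sum>n<N. hom_dev_mean f (map x [0..<Suc n])) = (\<Sum>n<N. hom_dev_mean f (take (Suc n) xs))"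
    by (intro sum.cong refl arg_cong[of _ _ "hom_dev_mean f"]) (simp add: xs_def take_map)
  also have "\<dots> \<le> (\<Sum>n<N. hom_dev_mean f (take (Suc n) zs))"
    unfolding zs_def using xs by (intro sum_mono mean_take_le_sorted) auto
  also have "\<dots> = (\<Sum>n<N. hom_dev_mean f (map ((!) zs) [0..<Suc n]))"
    using zs(1) by (intro sum.cong refl arg_cong[of _ _ "hom_dev_mean f"] nth_equalityI)
      (auto simp del: upt_Suc)
  also have "\<dots> = (\<Sum>n=1..N. hom_dev_mean f (map ((!) zs) [0..<n]))"
    by (simp only: One_nat_def sum.atLeast1_atMost_eq)
  also have "\<dots> \<le> c * (\<Sum>k<N. x k)"
  proof -
    have zpos: "0 < zs ! k" if "k < N" for k
      using that nth_mem[of k zs] xs(2) zs by auto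
    have "0 \<le> \<Phi> ((\<Sum>n=1..N. hom_dev_mean f (map ((!) zs) [0..<n])) / (\<Sum>k<N. zs ! k))"
      using sorted_rev_nth_mono[OF zs(4)] zs(1) zpos False
      by (intro \<Phi>_mean_ratio_nonneg) auto
    then have "(\<Sum>n=1..N. hom_dev_mean f (map ((!) zs) [0..<n])) / (\<Sum>k<N. zs ! k) \<le> c"
      using c by (meson not_le)
    moreover have "0 < (\<Sum>k<N. x k)" using False pos by (intro sum_pos) auto
    ultimately show ?thesis by (simp add: X field_simps)
  qed
  finally show ?thesis .
qed simp

lemma hardy_bound_mean:
  assumes c: "0 < c" "\<And>r. c < r \<Longrightarrow> \<Phi> r < 0"
  shows "hardy_bound (hom_dev_mean f) (ennreal c)"
  unfolding hardy_bound_def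
proof (intro allI impI)
  fix x :: "nat \<Rightarrow> real" assume "\<forall>n. 0 < x n"
  then have x: "0 < x n" for n by blast
  have M: "0 \<le> hom_dev_mean f (map x [0..<Suc n])" for n
    using x by (intro less_imp_le mean_solves) auto
  show "(\<Sum>n. ennreal (hom_dev_mean f (map x [0..<Suc n]))) \<le> ennreal c * (\<Sum>n. ennreal (x n))"
  proof (rule suminf_le_const)
    fix N
    have "(\<Sum>n<N. ennreal (hom_dev_mean f (map x [0..<Suc n])))
        = ennreal (\<Sum>n<N. hom_dev_mean f (map x [0..<Suc n]))"
      using M by (intro sum_ennreal) auto
    also have "\<dots> \<le> ennreal (c * (\<Sum>k<N. x k))"
      by (intro ennreal_leI sum_means_le c x)
    also have "\<dots> = ennreal c * (\<Sum>k<N. ennreal (x k))"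
      using c x by (simp add: ennreal_mult' sum_ennreal less_imp_le sum_nonneg)
    also have "\<dots> \<le> ennreal c * (\<Sum>k. ennreal (x k))"
      by (intro mult_left_mono sum_le_suminf) auto
    finally show "(\<Sum>n<N. ennreal (hom_dev_mean f (map x [0..<Suc n])))
        \<le> ennreal c * (\<Sum>k. ennreal (x k))" .
  qed simp
qed

end

end

section \<open>Lower bounds for the Hardy constant\<close>

text \<open>A Hardy inequality for \<open>1, 1/2, \<dots>, 1/N\<close>, continued by a geometric tail to keep the entries
  positive, compares \<open>d\<close> times a harmonic sum with \<open>C\<close> times a harmonic sum, up to bounded terms.
  As the harmonic series diverges, \<open>d \<le> C\<close>.\<close>

lemma hardy_bound_ge:
  assumes ev: "\<forall>\<^sub>F n in sequentially. d / real n \<le> M (map (\<lambda>k. 1 / real (Suc k)) [0..<n])"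
    and d: "0 \<le> d" and C: "hardy_bound M C"
  shows "ennreal d \<le> C"
proof (cases C)
  case (real C')
  obtain m where m: "d / real n \<le> M (map (\<lambda>k. 1 / real (Suc k)) [0..<n])" if "m \<le> n" for n
    using ev by (auto simp: eventually_sequentially)
  have bound: "(d - C') * harm N \<le> C' + d * harm m" if "m \<le> N" for N
  proof -
    define x where "x k = (if k < N then 1 / real (Suc k) else (1 / 2) ^ Suc k)" for k
    have "(\<lambda>k. (if k < N then 1 / real (Suc k) else 0) + (1 / 2) ^ Suc k) sums (harm N + 1)"
      unfolding harm_altdef
      using sums_add[OF sums_If_finite_set[of "{..<N}" "\<lambda>k. 1 / real (Suc k)"] power_half_series]
      by (simp add: inverse_eq_divide del: of_nat_Suc)
    then have "(\<Sum>k. ennreal ((if k < N then 1 / real (Suc k) else 0) + (1 / 2) ^ Suc k))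
        = ennreal (harm N + 1)"
      by (intro suminf_ennreal_eq) auto
    moreover have "(\<Sum>k. ennreal (x k))
        \<le> (\<Sum>k. ennreal ((if k < N then 1 / real (Suc k) else 0) + (1 / 2) ^ Suc k))"
      by (intro suminf_le ennreal_leI) (auto simp: x_def)
    ultimately have X: "(\<Sum>k. ennreal (x k)) \<le> ennreal (harm N + 1)" by simp
    have "ennreal (d * (harm N - harm m)) = ennreal (\<Sum>n=m..<N. d / real (Suc n))"
    proof -
      have "harm N = harm m + (\<Sum>n=m..<N. inverse (real (Suc n)))"
        unfolding harm_altdef lessThan_atLeast0 using that by (simp add: sum.atLeastLessThan_concat)
      then show ?thesis by (simp add: sum_distrib_left divide_inverse)
    qed
    also have "\<dots> = (\<Sum>n=m..<N. ennreal (d / real (Suc n)))"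
      using d by (intro sum_ennreal[symmetric]) auto
    also have "\<dots> \<le> (\<Sum>n=m..<N. ennreal (M (map x [0..<Suc n])))"
    proof (intro sum_mono ennreal_leI)
      fix n assume n: "n \<in> {m..<N}"
      have "map x [0..<Suc n] = map (\<lambda>k. 1 / real (Suc k)) [0..<Suc n]"
        using n by (intro map_cong) (auto simp: x_def)
      then show "d / real (Suc n) \<le> M (map x [0..<Suc n])"
        using m[of "Suc n"] n by (metis atLeastLessThan_iff le_SucI)
    qed
    also have "\<dots> \<le> (\<Sum>n. ennreal (M (map x [0..<Suc n])))"
      by (intro sum_le_suminf) auto
    also have "\<dots> \<le> C * (\<Sum>k. ennreal (x k))"
      using C[unfolded hardy_bound_def, rule_format, of x] by (simp add: x_def del: upt_Suc of_nat_Suc)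
    also have "\<dots> \<le> C * ennreal (harm N + 1)"
      using X by (intro mult_left_mono) auto
    also have "\<dots> = ennreal (C' * (harm N + 1))"
      using real by (simp add: ennreal_mult harm_nonneg)
    finally have "d * (harm N - harm m) \<le> C' * (harm N + 1)"
      using real by (simp add: ennreal_le_iff harm_nonneg)
    then show ?thesis by (simp add: algebra_simps)
  qed
  have "d \<le> C'"
  proof (rule ccontr)
    assume "\<not> d \<le> C'"
    then have "\<forall>\<^sub>F N in sequentially. (C' + d * harm m) / (d - C') < harm N"
      using harm_at_top by (auto simp: filterlim_at_top_dense)
    then have "\<forall>\<^sub>F N in sequentially. False"
      using eventually_ge_at_top[of m]
    proof eventually_elim
      case (elim N)
      then show False using bound[of N] \<open>\<not> d \<le> C'\<close> by (simp add: field_simps)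
    qed
    then show False by simp
  qed
  then show ?thesis using real by (simp add: ennreal_leI)
qed simp

context deviation
begin

lemma hardy_constant_ge:
  assumes "0 < \<epsilon>" "\<epsilon> \<le> 1" "\<epsilon> \<le> d" "0 < integral {\<epsilon>..d} \<phi>"
  shows "ennreal d \<le> hardy_constant (hom_dev_mean f)"
proof (rule hardy_bound_ge[OF eventually_le_mean_harmonic[OF assms]])
  show "hardy_bound (hom_dev_mean f) (hardy_constant (hom_dev_mean f))"
    by (intro hardy_constant_least(1) mean_solves(1))
qed (use assms in simp)

section \<open>Convergence of the integral and the value of the constant\<close>

lemma set_integrable_\<phi>:
  assumes "(\<integral>\<^sup>+t\<in>{0<..<1}. ennreal (\<phi> t) \<partial>lborel) < \<infinity>"
  shows "set_integrable lborel {0<..<r} \<phi>"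
proof -
  have "set_integrable lborel {0<..<1} \<phi>"
    unfolding set_integrable_def
  proof (rule integrableI_nonneg)
    show "(\<lambda>t. indicator {0<..<1} t *\<^sub>R \<phi> t) \<in> borel_measurable lborel"
      unfolding measurable_lborel2
      by (intro borel_measurable_continuous_on_indicator continuous_on_subset[OF continuous_\<phi>]) auto
    show "AE t in lborel. 0 \<le> indicator {0<..<1} t *\<^sub>R \<phi> t"
      by (auto simp: indicator_def intro!: \<phi>_nonneg)
    have "(\<integral>\<^sup>+t. ennreal (indicator {0<..<1} t *\<^sub>R \<phi> t) \<partial>lborel)
        = (\<integral>\<^sup>+t\<in>{0<..<1}. ennreal (\<phi> t) \<partial>lborel)"
      by (intro nn_integral_cong) (auto simp: indicator_def)
    then show "(\<integral>\<^sup>+t. ennreal (indicator {0<..<1} t *\<^sub>R \<phi> t) \<partial>lborel) < \<infinity>"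
      using assms by simp
  qed
  moreover have "set_integrable lborel {1..max 1 r} \<phi>"
    by (intro borel_integrable_atLeastAtMost' continuous_on_subset[OF continuous_\<phi>]) auto
  ultimately have "set_integrable lborel ({0<..<1} \<union> {1..max 1 r}) \<phi>"
    by (intro set_integrable_Un) auto
  then show ?thesis
    by (rule set_integrable_subset) auto
qed

text \<open>On \<open>(0, 1]\<close> the integrand is nonnegative, so the integral over \<open>(0, 1)\<close> is the supremum of
  the integrals over \<open>[1 / (n + 2), 1]\<close>.\<close>

lemma nn_integral_\<phi>_finite:
  assumes bound: "\<And>\<epsilon>. 0 < \<epsilon> \<Longrightarrow> \<epsilon> < 1 \<Longrightarrow> integral {\<epsilon>..1} \<phi> \<le> B"
  shows "(\<integral>\<^sup>+t\<in>{0<..<1}. ennreal (\<phi> t) \<partial>lborel) < \<infinity>"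
proof -
  define A where "A n = {1 / real (n + 2)..1}" for n
  define g where "g n t = ennreal (indicator (A n) t *\<^sub>R \<phi> t)" for n t
  have A: "A n \<subseteq> {0<..1}" for n
  proof
    fix t assume "t \<in> A n"
    then have t: "1 / real (n + 2) \<le> t" "t \<le> 1" by (auto simp: A_def)
    have "0 < 1 / real (n + 2)" by simp
    with t show "t \<in> {0<..1}" unfolding greaterThanAtMost_iff by (blast intro: less_le_trans)
  qed
  have nonneg: "0 \<le> \<phi> t" if "t \<in> A n" for n t using A[of n] that \<phi>_nonneg by auto
  have meas: "g n \<in> borel_measurable lborel" for n
  proof -
    have "(\<lambda>t. indicator (A n) t *\<^sub>R \<phi> t) \<in> borel_measurable borel"
      using A[of n]
      by (intro borel_measurable_continuous_on_indicator continuous_on_subset[OF continuous_\<phi>])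
         (auto simp: A_def)
    then show ?thesis unfolding g_def[abs_def] by simp
  qed
  have inc: "incseq g"
  proof (intro incseq_SucI le_funI)
    fix n t
    have "A n \<subseteq> A (Suc n)" by (auto simp: A_def field_simps intro: order_trans[rotated])
    then show "g n t \<le> g (Suc n) t"
      using nonneg[of t "Suc n"] by (auto simp: g_def indicator_def intro!: ennreal_leI)
  qed
  have int: "integral\<^sup>N lborel (g n) \<le> ennreal B" for n
  proof -
    have "(\<phi> has_integral integral (A n) \<phi>) (A n)"
      unfolding A_def by (intro integrable_integral integrable_\<phi>) auto
    from nn_integral_has_integral_lebesgue[OF nonneg[of _ n] this]
    have "integral\<^sup>N lborel (g n) = ennreal (integral (A n) \<phi>)"
      by (simp add: g_def[abs_def])
    also have "\<dots> \<le> ennreal B"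
      unfolding A_def by (intro ennreal_leI bound) auto
    finally show ?thesis .
  qed
  have "(\<integral>\<^sup>+t\<in>{0<..<1}. ennreal (\<phi> t) \<partial>lborel) \<le> (\<integral>\<^sup>+t. (SUP n. g n t) \<partial>lborel)"
  proof (intro nn_integral_mono)
    fix t :: real
    show "ennreal (\<phi> t) * indicator {0<..<1} t \<le> (SUP n. g n t)"
    proof (cases "t \<in> {0<..<1}")
      case True
      then obtain n where n: "inverse (real (Suc n)) < t" using reals_Archimedean by auto
      have "1 / real (n + 2) \<le> inverse (real (Suc n))" by (simp add: field_simps)
      then have "t \<in> A n" using n True by (auto simp: A_def)
      then have "ennreal (\<phi> t) * indicator {0<..<1} t = g n t" using True by (simp add: g_def)
      also have "\<dots> \<le> (SUP n. g n t)" by (intro SUP_upper) auto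
      finally show ?thesis .
    qed simp
  qed
  also have "\<dots> = (SUP n. integral\<^sup>N lborel (g n))"
    by (rule nn_integral_monotone_convergence_SUP[OF inc meas])
  also have "\<dots> \<le> ennreal B"
    by (intro SUP_least int)
  finally show ?thesis by (rule le_less_trans) simp
qed

text \<open>If \<open>d\<close> exceeds the Hardy constant, no integral of \<open>\<phi>\<close> over \<open>[\<epsilon>, d]\<close> with \<open>\<epsilon> \<le> 1\<close> is
  positive, which bounds the integrals over \<open>[\<epsilon>, 1]\<close> uniformly in \<open>\<epsilon>\<close>.\<close>

lemma hardy_mean_imp_integral_finite:
  assumes "hardy_mean (hom_dev_mean f)"
  shows "(\<integral>\<^sup>+t\<in>{0<..<1}. ennreal (\<phi> t) \<partial>lborel) < \<infinity>"
proof -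
  have "hardy_constant (hom_dev_mean f) < top" using assms by (simp add: hardy_mean_def)
  then obtain K where K: "0 \<le> K" "hardy_constant (hom_dev_mean f) = ennreal K"
    unfolding less_top_ennreal by blast
  define d where "d = K + 1"
  have d: "1 \<le> d" "\<not> ennreal d \<le> hardy_constant (hom_dev_mean f)"
    using K by (auto simp: d_def ennreal_le_iff)
  show ?thesis
  proof (rule nn_integral_\<phi>_finite)
    fix \<epsilon> :: real assume e: "0 < \<epsilon>" "\<epsilon> < 1"
    have "integral {\<epsilon>..1} \<phi> + integral {1..d} \<phi> = integral {\<epsilon>..d} \<phi>"
      using e d by (intro Henstock_Kurzweil_Integration.integral_combine integrable_\<phi>) auto
    moreover have "integral {\<epsilon>..d} \<phi> \<le> 0"
      using hardy_constant_ge[of \<epsilon> d] e d by fastforce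
    ultimately show "integral {\<epsilon>..1} \<phi> \<le> - integral {1..d} \<phi>" by simp
  qed
qed

text \<open>For \<open>d < c\<close> the integral of \<open>\<phi>\<close> over \<open>[\<epsilon>, d]\<close> tends to \<open>\<Phi> d > 0\<close> as \<open>\<epsilon>\<close> tends to \<open>0\<close>,
  so the lower bound applies to every such \<open>d\<close>.\<close>

lemma hardy_constant_eq:
  assumes int01: "\<phi> integrable_on {0..1}"
    and c: "0 < c" "\<And>r. 0 < r \<Longrightarrow> r < c \<Longrightarrow> 0 < \<Phi> r" "\<And>r. c < r \<Longrightarrow> \<Phi> r < 0"
  shows "hardy_constant (hom_dev_mean f) = ennreal c"
proof (rule antisym)
  show "hardy_constant (hom_dev_mean f) \<le> ennreal c"
    using mean_solves(1) hardy_bound_mean[OF int01] c by (intro hardy_constant_least(2)) auto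
  have le: "ennreal d \<le> hardy_constant (hom_dev_mean f)" if d: "0 < d" "d < c" for d
  proof -
    have "continuous_on {0..d} \<Phi>"
      unfolding \<Phi>_def
      by (rule indefinite_integral_continuous_1[OF integrable_\<phi>_0[OF int01]])
    then have "(\<Phi> \<longlongrightarrow> \<Phi> 0) (at_right 0)"
      using d by (simp add: continuous_on_Icc_at_rightD)
    moreover have "\<Phi> 0 < \<Phi> d" using c(2)[of d] d by (simp add: \<Phi>_def)
    ultimately have "\<forall>\<^sub>F \<epsilon> in at_right 0. \<Phi> \<epsilon> < \<Phi> d"
      by (rule order_tendstoD)
    moreover have "\<forall>\<^sub>F \<epsilon> in at_right 0. \<epsilon> \<in> {0<..<min 1 d}"
      using d by (intro eventually_at_right_real) auto
    ultimately have "\<forall>\<^sub>F \<epsilon> in at_right 0. \<Phi> \<epsilon> < \<Phi> d \<and> \<epsilon> \<in> {0<..<min 1 d}"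
      by (rule eventually_conj)
    then obtain \<epsilon> where "\<Phi> \<epsilon> < \<Phi> d" "0 < \<epsilon>" "\<epsilon> < 1" "\<epsilon> < d"
      using eventually_happens[of _ "at_right (0::real)"] by auto
    then show ?thesis
      using \<Phi>_diff[OF int01, of \<epsilon> d] by (intro hardy_constant_ge[of \<epsilon>]) auto
  qed
  show "ennreal c \<le> hardy_constant (hom_dev_mean f)"
  proof (cases "hardy_constant (hom_dev_mean f)")
    case (real K)
    have "c \<le> K"
    proof (rule dense_le_bounded[of 0])
      fix d assume "0 < d" "d < c"
      then show "d \<le> K" using le[of d] real by (simp add: ennreal_le_iff)
    qed (use c in simp)
    then show ?thesis using real by (simp add: ennreal_leI)
  qed simp
qed

end

theorem theorem3p4:
  fixes f :: "real \<Rightarrow> real"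
  assumes "strict_mono_on {0<..} f"
    and "concave_on {0<..} f"
    and "f 1 = 0"
  shows "(hardy_mean (hom_dev_mean f) \<longleftrightarrow>
            (\<integral>\<^sup>+t\<in>{0<..<1}. ennreal (f (1 / t)) \<partial>lborel) < \<infinity>) \<and>
         ((\<integral>\<^sup>+t\<in>{0<..<1}. ennreal (f (1 / t)) \<partial>lborel) < \<infinity> \<longrightarrow>
            (\<exists>c>0. set_integrable lborel {0<..<c} (\<lambda>t. f (1 / t)) \<and>
                   (LBINT t:{0<..<c}. f (1 / t)) = 0 \<and>
                   (\<forall>c'>0. (LBINT t:{0<..<c'}. f (1 / t)) = 0 \<longrightarrow> c' = c) \<and>
                   hardy_constant (hom_dev_mean f) = ennreal c))"
proof -
  interpret deviation f by standard (fact assms)+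
  have sharp: "\<exists>c>0. set_integrable lborel {0<..<c} \<phi> \<and> (LBINT t:{0<..<c}. \<phi> t) = 0 \<and>
      (\<forall>c'>0. (LBINT t:{0<..<c'}. \<phi> t) = 0 \<longrightarrow> c' = c) \<and>
      hardy_constant (hom_dev_mean f) = ennreal c"
    if fin: "(\<integral>\<^sup>+t\<in>{0<..<1}. ennreal (\<phi> t) \<partial>lborel) < \<infinity>"
  proof -
    note int = set_integrable_\<phi>[OF fin]
    have int01: "\<phi> integrable_on {0..1}"
      using set_borel_integral_eq_integral(1)[OF int, of 1] by (simp add: integrable_on_Icc_iff_Ioo)
    have LB: "(LBINT t:{0<..<r}. \<phi> t) = \<Phi> r" for r
      using set_borel_integral_eq_integral(2)[OF int]
      by (simp add: \<Phi>_def integral_open_interval_real)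
    obtain c where c: "0 < c" "\<Phi> c = 0" "\<And>r. 0 < r \<Longrightarrow> r < c \<Longrightarrow> 0 < \<Phi> r" "\<And>r. c < r \<Longrightarrow> \<Phi> r < 0"
      using \<Phi>_zero_exists[OF int01] by blast
    have "r = c" if "0 < r" "\<Phi> r = 0" for r
      using c(3)[of r] c(4)[of r] that by (metis less_irrefl less_linear)
    moreover have "hardy_constant (hom_dev_mean f) = ennreal c"
      by (rule hardy_constant_eq[OF int01 c(1,3,4)])
    ultimately show ?thesis
      unfolding LB using c(1,2) int by metis
  qed
  have "hardy_mean (hom_dev_mean f)"
    if fin: "(\<integral>\<^sup>+t\<in>{0<..<1}. ennreal (\<phi> t) \<partial>lborel) < \<infinity>"
  proof -
    obtain c where "hardy_constant (hom_dev_mean f) = ennreal c"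
      using sharp[OF fin] by blast
    then show ?thesis unfolding hardy_mean_def by simp
  qed
  then show ?thesis
    using sharp hardy_mean_imp_integral_finite by blast
qed

end
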